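(* Let $\phi=(1+\sqrt5)/2$ and, for $n\ge 0$, let $A_n=\lfloor \phi n\rfloor$ and $B_n=\lfloor \phi^2 n\rfloor$. The set of positions with nim-value $1$ in the game $\mathcal{W}_1$ is $$\{(0,1)\}\cup\{(A_n+2,\,B_n+2)\mid n\ge 0\}.$$
   Context: $\mathcal{W}_1$ is the following two-player game. A position is a pair $(a,b)$ of nonnegative integers (sizes of two piles of tokens); the piles are unordered, so $(a,b)$ and $(b,a)$ are identified, and a listed set of positions is understood up to this symmetry. Players alternate; a player who cannot move loses. Each move is one of: (i) remove a positive number of tokens from a single pile; (ii) remove an equal positive number of tokens from both piles, provided that neither pile has size less than $1$ after the move. The nim-value (Sprague-Grundy value) of a position is defined recursively as the least nonnegative integer that is not the nim-value of any position reachable from it in one move (so a terminal position has nim-value $0$). *)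

theory Defs
  imports Complex_Main "HOL-Library.Uprod"
begin

(* w1_move p q: q is reachable from p in one move. Positions are unordered pairs, so
   single_pile covers removal from either pile. *)
inductive w1_move :: "nat uprod \<Rightarrow> nat uprod \<Rightarrow> bool" where
  single_pile: "k > 0 \<Longrightarrow> w1_move (Upair (a + k) b) (Upair a b)"
| both_piles: "k > 0 \<Longrightarrow> a \<ge> 1 \<Longrightarrow> b \<ge> 1 \<Longrightarrow> w1_move (Upair (a + k) (b + k)) (Upair a b)"

lift_definition total_tokens :: "nat uprod \<Rightarrow> nat" is "\<lambda>(a, b). a + b"
  by auto

lemma w1_move_total_tokens: "w1_move p q \<Longrightarrow> total_tokens q < total_tokens p"
  by (induction rule: w1_move.induct) (simp_all add: total_tokens.abs_eq Upair.abs_eq)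

(* Only meaningful for S with nonempty complement; here S is always finite, since a position
   has finitely many options. *)
definition mex :: "nat set \<Rightarrow> nat" where
  "mex S = (LEAST n. n \<notin> S)"

function w1_nim_value :: "nat uprod \<Rightarrow> nat" where
  "w1_nim_value p = mex (w1_nim_value ` {q. w1_move p q})"
  by auto
termination
  by (relation "measure total_tokens") (auto simp: w1_move_total_tokens)

declare w1_nim_value.simps [simp del]

definition golden_ratio :: real where
  "golden_ratio = (1 + sqrt 5) / 2"

definition A :: "nat \<Rightarrow> nat" where
  "A n = nat \<lfloor>golden_ratio * real n\<rfloor>"

definition B :: "nat \<Rightarrow> nat" where
  "B n = nat \<lfloor>golden_ratio\<^sup>2 * real n\<rfloor>"

end

theory Submission
  imports Defs
begin

text \<open>
  Call \<open>(A n, B n)\<close> a Wythoff pair. In ordinary Wythoff Nim these pairs are exactly the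
  positions from which the player to move loses. This rests on two facts: \<open>B n = A n + n\<close>, so the
  difference of a pair determines the pair, and every positive integer lies in exactly one of
  the ranges of \<open>A\<close> and \<open>B\<close> (Beatty's theorem for the golden ratio).

  If \<open>c \<ge> 1\<close>, the restriction on diagonal moves is invisible to positions both of whose piles
  have at least \<open>c\<close> tokens, as long as the play stays among such positions: there the game is
  Wythoff Nim with every pile increased by \<open>c\<close>. So the Wythoff pairs shifted by \<open>c\<close> form a set
  with no move inside it that can be reached from every other position with both piles \<open>\<ge> c\<close>
  (\<open>shifted_wythoff_stable\<close>, \<open>shifted_wythoff_absorbing\<close>).

  The remaining positions have a small pile and are checked directly. With an empty pile the
  game is one-pile Nim, which contributes \<open>(0,0)\<close> to nim-value 0 and \<open>(0,1)\<close> to nim-value 1. The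
  shift by 1 then completes the positions of nim-value 0, as a position without empty piles
  cannot move to \<open>(0,0)\<close>. For nim-value 1 the piles of size 1 are also special: a position
  \<open>(1,b)\<close> with \<open>b > 0\<close> can move to \<open>(1,0)\<close>, so it does not have nim-value 1.
  Positions with both piles \<open>\<ge> 2\<close> cannot move to \<open>(0,1)\<close>, which leaves the shift by 2. Shifts 1 and 2 are disjoint, because a common
  element would yield a diagonal move between two pairs with the same shift.
\<close>

section \<open>Wythoff pairs\<close>

lemma golden_ratio_squared: "golden_ratio\<^sup>2 = golden_ratio + 1"
  by (simp add: golden_ratio_def power2_eq_square field_simps)

lemma golden_ratio_mult_twice: "golden_ratio * (golden_ratio * x) = golden_ratio * x + x"
  using golden_ratio_squared by (simp add: power2_eq_square algebra_simps flip: mult.assoc)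

lemma golden_ratio_gt_1: "golden_ratio > 1"
proof -
  have "sqrt 5 > 1" by simp
  then show ?thesis by (simp add: golden_ratio_def)
qed

text \<open>The equation says that \<open>n / m\<close> is the golden ratio. In that case \<open>m / (n - m)\<close> is the golden
  ratio too, which starts an infinite descent.\<close>

lemma golden_equation_trivial:
  fixes n m :: nat
  assumes "n * n = n * m + m * m"
  shows "m = 0"
  using assms
proof (induction n arbitrary: m rule: less_induct)
  case (less n)
  show ?case
  proof (rule ccontr)
    assume "m \<noteq> 0"
    have "m < n"
    proof (rule ccontr)
      assume "\<not> m < n"
      then have "n * n \<le> n * m" by simp
      moreover have "m * m > 0" using \<open>m \<noteq> 0\<close> by simp
      ultimately show False using less.prems by linarith
    qed
    then obtain d where d: "n = m + d" "d > 0" using less_imp_add_positive by blast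
    have "m * m = m * d + d * d" using less.prems d by (simp add: algebra_simps)
    from less.IH[OF \<open>m < n\<close> this] d show False by simp
  qed
qed

lemma golden_ratio_irrational:
  assumes "golden_ratio * real m = real n"
  shows "m = 0"
proof -
  have "real n * real n = golden_ratio\<^sup>2 * (real m * real m)"
    by (simp add: assms[symmetric] power2_eq_square)
  also have "\<dots> = (golden_ratio * real m) * real m + real m * real m"
    by (simp add: golden_ratio_squared algebra_simps)
  finally have "real (n * n) = real (n * m + m * m)" by (simp add: assms)
  then show ?thesis using golden_equation_trivial of_nat_eq_iff by blast
qed

lemma A_eq_iff: "A n = m \<longleftrightarrow> real m \<le> golden_ratio * real n \<and> golden_ratio * real n < real m + 1"
proof -
  have "golden_ratio * real n \<ge> 0" using golden_ratio_gt_1 by simp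
  then show ?thesis unfolding A_def by (auto simp: nat_eq_iff floor_eq_iff)
qed

lemma B_eq: "B n = A n + n"
proof -
  have nonneg: "golden_ratio * real n \<ge> 0" using golden_ratio_gt_1 by simp
  have "\<lfloor>golden_ratio\<^sup>2 * real n\<rfloor> = \<lfloor>golden_ratio * real n\<rfloor> + int n"
    by (simp add: golden_ratio_squared algebra_simps)
  then show ?thesis unfolding A_def B_def using nonneg by (simp add: nat_add_distrib)
qed

lemma A_0: "A 0 = 0"
  by (simp add: A_def)

lemma A_strict_mono: "strict_mono A"
  unfolding strict_mono_Suc_iff
proof
  fix n
  have lo: "golden_ratio * real n \<ge> real (A n)" and hi: "golden_ratio * real (Suc n) < real (A (Suc n)) + 1"
    using A_eq_iff by blast+
  have "golden_ratio * real (Suc n) = golden_ratio * real n + golden_ratio"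
    by (simp add: algebra_simps)
  with lo hi golden_ratio_gt_1 have "real (A n) < real (A (Suc n))" by linarith
  then show "A n < A (Suc n)" by simp
qed

text \<open>Beatty's theorem, covering half. If \<open>m\<close> is not a value of \<open>A\<close>, then some gap of the multiples
  of the golden ratio contains the whole interval from \<open>m\<close> to \<open>m + 1\<close>. Since
  \<open>1 / golden_ratio + 1 / golden_ratio\<^sup>2 = 1\<close>, counting the multiples of the golden ratio below
  \<open>m\<close> tells which multiple of its square lies in that interval.\<close>

lemma A_B_cover: "\<exists>n. m = A n \<or> m = B n"
proof (cases "m = 0")
  case True
  then show ?thesis using A_0 by metis
next
  case False
  let ?g = golden_ratio
  define r where "r = (LEAST n. real m \<le> ?g * real n)"
  have "real m \<le> ?g * real m" using golden_ratio_gt_1 by (simp add: mult_le_cancel_right1)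
  then have upper: "real m \<le> ?g * real r" and "r \<le> m"
    unfolding r_def by (rule LeastI, rule Least_le)
  from upper False have "r \<noteq> 0" by (intro notI) simp
  then have "\<not> real m \<le> ?g * real (r - 1)" unfolding r_def by (intro not_less_Least) simp
  then have lower: "?g * (real r - 1) < real m" using \<open>r \<noteq> 0\<close> by (simp add: of_nat_diff)
  show ?thesis
  proof (cases "?g * real r < real m + 1")
    case True
    with upper have "A r = m" using A_eq_iff by simp
    then show ?thesis by blast
  next
    case False
    \<comment> \<open>There are \<open>r - 1\<close> positive multiples of the golden ratio below \<open>m\<close>. The other \<open>k\<close> of the
      numbers from 1 to \<open>m\<close> must be \<open>B 1, \<dots>, B k\<close>, and \<open>m\<close> is the last of them.\<close>
    define k where "k = m + 1 - r"
    have k: "real k = real m + 1 - real r" using \<open>r \<le> m\<close> by (simp add: k_def of_nat_diff)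
    have "?g * real r \<noteq> real (m + 1)"
      using golden_ratio_irrational[of r "m + 1"] \<open>r \<noteq> 0\<close> by blast
    with False have "real m + 1 < ?g * real r" by simp
    then have "?g * (real m + 1) < ?g * (?g * real r)"
      using golden_ratio_gt_1 by (intro mult_strict_left_mono) auto
    then have "?g * real k < real r"
      unfolding golden_ratio_mult_twice by (simp add: k algebra_simps)
    moreover have "?g * (?g * (real r - 1)) < ?g * real m"
      using lower golden_ratio_gt_1 by (intro mult_strict_left_mono) auto
    then have "real r - 1 \<le> ?g * real k"
      unfolding golden_ratio_mult_twice by (simp add: k algebra_simps)
    ultimately have "A k = r - 1"
      using \<open>r \<noteq> 0\<close> by (simp add: A_eq_iff of_nat_diff)
    then have "B k = m" using \<open>r \<noteq> 0\<close> \<open>r \<le> m\<close> by (simp add: B_eq k_def)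
    then show ?thesis by blast
  qed
qed

text \<open>Beatty's theorem, disjointness half. A common value \<open>v\<close> of \<open>A n\<close> and \<open>B m\<close> squeezes the integer
  \<open>n + m\<close> between \<open>v\<close> and \<open>v + 1\<close>. The lower bound is strict for \<open>n > 0\<close> by irrationality.\<close>

lemma A_eq_B_imp_0:
  assumes "A n = B m"
  shows "n = 0" and "m = 0"
proof -
  let ?g = golden_ratio
  define v where "v = A n"
  have n: "real v \<le> ?g * real n" "?g * real n < real v + 1"
    using A_eq_iff[of n v] by (simp_all add: v_def)
  have "real (A m) \<le> ?g * real m" "?g * real m < real (A m) + 1"
    using A_eq_iff[of m "A m"] by simp_all
  moreover have "real (A m) + real m = real v"
    using assms B_eq[of m] by (simp add: v_def flip: of_nat_add)
  ultimately have m: "real v \<le> ?g * real m + real m" "?g * real m + real m < real v + 1"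
    by linarith+
  have "n = 0"
  proof (rule ccontr)
    assume "n \<noteq> 0"
    then have "real v < ?g * real n"
      using n(1) golden_ratio_irrational[of n v] by fastforce
    then have "?g * real v < ?g * (?g * real n)"
      using golden_ratio_gt_1 by (intro mult_strict_left_mono) auto
    then have low: "?g * real v < ?g * real n + real n"
      by (simp only: golden_ratio_mult_twice)
    have "?g * (?g * real n) < ?g * (real v + 1)"
      using n(2) golden_ratio_gt_1 by (intro mult_strict_left_mono) auto
    then have high: "?g * real n + real n < ?g * (real v + 1)"
      by (simp only: golden_ratio_mult_twice)
    show False
    proof (cases "n + m \<le> v")
      case True
      then have le: "real n + real m \<le> real v" by linarith
      then have "?g * (real n + real m) \<le> ?g * real v"
        using golden_ratio_gt_1 by (intro mult_left_mono) auto
      then show False using low m(1) le by (simp add: algebra_simps)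
    next
      case False
      then have le: "real v + 1 \<le> real n + real m" by linarith
      then have "?g * (real v + 1) \<le> ?g * (real n + real m)"
        using golden_ratio_gt_1 by (intro mult_left_mono) auto
      then show False using high m(2) le by (simp add: algebra_simps)
    qed
  qed
  then show "n = 0" .
  then show "m = 0" using assms by (simp add: B_eq A_0)
qed

section \<open>Shifted Wythoff pairs in the game\<close>

definition shifted_wythoff :: "nat \<Rightarrow> nat uprod set" where
  "shifted_wythoff c = {Upair (A n + c) (B n + c) | n. True}"

lemma Upair_swap: "Upair a b = Upair b a"
  by simp

lemma w1_move_first_pile: "a' < a \<Longrightarrow> w1_move (Upair a b) (Upair a' b)"
  using single_pile[of "a - a'" a' b] by simp

lemma w1_move_second_pile: "b' < b \<Longrightarrow> w1_move (Upair a b) (Upair a b')"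
  using w1_move_first_pile[of b' b a] by (simp add: Upair_swap)

text \<open>A move on one pile keeps a pile size, and a move on both keeps the difference of the sizes; either
  datum determines a Wythoff pair.\<close>

lemma shifted_wythoff_stable:
  assumes "p \<in> shifted_wythoff c" "q \<in> shifted_wythoff c"
  shows "\<not> w1_move p q"
proof
  assume move: "w1_move p q"
  obtain n m where p: "p = Upair (A n + c) (B n + c)" and q: "q = Upair (A m + c) (B m + c)"
    using assms by (auto simp: shifted_wythoff_def)
  have "n = m"
    using move
  proof cases
    case (single_pile k a b)
    then have "b = A n + c \<or> b = B n + c" "b = A m + c \<or> b = B m + c"
      using p q by auto
    moreover have "A n = A m \<Longrightarrow> n = m"
      using A_strict_mono by (simp add: strict_mono_eq)
    moreover have "B n = B m \<Longrightarrow> n = m"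
      using A_strict_mono by (metis B_eq add_less_mono linorder_neqE_nat nat_less_le strict_monoD)
    ultimately show ?thesis
      using A_eq_B_imp_0[of n m] A_eq_B_imp_0[of m n] by force
  next
    case (both_piles k a b)
    then show ?thesis using p q by (auto simp: B_eq)
  qed
  then show False using w1_move_total_tokens[OF move] p q by simp
qed

text \<open>Wythoff's winning strategy. The smaller pile is some \<open>A n\<close> or \<open>B n\<close>. If the other pile
  exceeds the partner of this number, reduce it to the partner. Otherwise the piles are
  \<open>A n\<close> and \<open>A n + d\<close> with \<open>d < n\<close>, and a diagonal move leads to the pair with index \<open>d\<close>.\<close>

lemma shifted_wythoff_absorbing:
  assumes "c \<ge> 1" "a \<ge> c" "b \<ge> c" "Upair a b \<notin> shifted_wythoff c"
  shows "\<exists>q \<in> shifted_wythoff c. w1_move (Upair a b) q"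
  using assms(2-)
proof (induction a b rule: linorder_wlog)
  case (sym a b)
  then show ?case by (simp add: Upair_swap)
next
  case (le a b)
  have pair: "Upair (A n + c) (B n + c) \<in> shifted_wythoff c" for n
    by (auto simp: shifted_wythoff_def)
  obtain x y where xy: "a = x + c" "b = y + c" "x \<le> y"
    using le by (metis add.commute add_le_cancel_left le_add_diff_inverse)
  obtain n where "x = A n \<or> x = B n" using A_B_cover by blast
  then consider "x = B n" | "x = A n" "B n \<le> y" | "x = A n" "y < B n" by linarith
  then show ?case
  proof cases
    case 1
    have "y \<noteq> A n" using le.prems pair[of n] 1 xy by (auto simp: Upair_swap)
    then have "A n < y" using 1 xy by (simp add: B_eq)
    then have "w1_move (Upair a b) (Upair (B n + c) (A n + c))"
      using 1 xy by (simp add: w1_move_second_pile)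
    then show ?thesis using pair[of n] by (metis Upair_swap)
  next
    case 2
    have "y \<noteq> B n" using le.prems pair[of n] 2 xy by auto
    then have "w1_move (Upair a b) (Upair (A n + c) (B n + c))"
      using 2 xy by (simp add: w1_move_second_pile)
    then show ?thesis using pair by blast
  next
    case 3
    define d where "d = y - x"
    have d: "y = x + d" "d < n" using 3 xy by (auto simp: d_def B_eq)
    then have "A d < A n" using A_strict_mono by (simp add: strict_monoD)
    then have "w1_move (Upair a b) (Upair (A d + c) (B d + c))"
      using both_piles[of "A n - A d" "A d + c" "B d + c"] d xy 3 \<open>c \<ge> 1\<close>
      by (simp add: B_eq algebra_simps)
    then show ?thesis using pair by blast
  qed
qed

text \<open>Adding one token to both piles raises the shift, so a position of both shifts would be one
  diagonal move away from another position of the smaller shift.\<close>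

lemma shifted_wythoff_Suc_disjoint:
  assumes "c \<ge> 1"
  shows "shifted_wythoff c \<inter> shifted_wythoff (Suc c) = {}"
proof -
  have "Upair (A n + Suc c) (B n + Suc c) \<notin> shifted_wythoff c" for n
  proof -
    have "w1_move (Upair (A n + Suc c) (B n + Suc c)) (Upair (A n + c) (B n + c))"
      using both_piles[of 1 "A n + c" "B n + c"] assms by simp
    moreover have "Upair (A n + c) (B n + c) \<in> shifted_wythoff c"
      by (auto simp: shifted_wythoff_def)
    ultimately show ?thesis using shifted_wythoff_stable by blast
  qed
  then show ?thesis unfolding shifted_wythoff_def[of "Suc c"] by blast
qed

lemma shifted_wythoff_piles_ge:
  "Upair a b \<in> shifted_wythoff c \<Longrightarrow> a \<ge> c \<and> b \<ge> c"
  by (auto simp: shifted_wythoff_def)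

section \<open>Positions of small nim-value\<close>

lemma finite_moves: "finite {q. w1_move p q}"
proof (rule finite_subset)
  show "{q. w1_move p q} \<subseteq> (\<lambda>(a, b). Upair a b) ` ({..total_tokens p} \<times> {..total_tokens p})"
  proof
    fix q assume "q \<in> {q. w1_move p q}"
    then have less: "total_tokens q < total_tokens p" by (simp add: w1_move_total_tokens)
    obtain a b where "q = Upair a b" by (cases q)
    moreover from this have "total_tokens q = a + b"
      by (simp add: total_tokens.abs_eq Upair.abs_eq)
    ultimately show "q \<in> (\<lambda>(a, b). Upair a b) ` ({..total_tokens p} \<times> {..total_tokens p})"
      using less by force
  qed
qed auto

lemma mex_notin: "finite S \<Longrightarrow> mex S \<notin> S"
  unfolding mex_def by (rule LeastI_ex) (rule ex_new_if_finite[OF infinite_UNIV_nat])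

lemma less_mex_in: "n < mex S \<Longrightarrow> n \<in> S"
  unfolding mex_def using not_less_Least by blast

lemma mex_eq_iff:
  assumes "finite S"
  shows "mex S = n \<longleftrightarrow> n \<notin> S \<and> {..<n} \<subseteq> S"
  using mex_notin[OF assms] less_mex_in[of _ S]
  by (metis lessThan_iff linorder_neqE_nat subset_iff)

lemma nim_value_eq_0_iff:
  "w1_nim_value p = 0 \<longleftrightarrow> (\<forall>q. w1_move p q \<longrightarrow> w1_nim_value q \<noteq> 0)"
  by (subst w1_nim_value.simps) (auto simp: mex_eq_iff finite_moves)

lemma nim_value_eq_1_iff:
  "w1_nim_value p = 1 \<longleftrightarrow>
    w1_nim_value p \<noteq> 0 \<and> (\<forall>q. w1_move p q \<longrightarrow> w1_nim_value q \<noteq> 1)"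
proof -
  have "w1_nim_value p = 1 \<longleftrightarrow>
      (\<exists>q. w1_move p q \<and> w1_nim_value q = 0) \<and> (\<forall>q. w1_move p q \<longrightarrow> w1_nim_value q \<noteq> 1)"
    by (subst w1_nim_value.simps) (auto simp: mex_eq_iff finite_moves image_iff lessThan_Suc)
  then show ?thesis using nim_value_eq_0_iff[of p] by simp
qed

text \<open>Deleting the positions of nim-value less than \<open>v\<close> leaves a game in which nim-value \<open>v\<close> marks the
  positions lost for the player to move. In a terminating game that set is characterised by being
  stable and absorbing. The next two lemmas are the cases \<open>v = 0\<close> and \<open>v = 1\<close>.\<close>

lemma nim_value_0_if_kernel:
  assumes stable: "\<And>p q. p \<in> P \<Longrightarrow> q \<in> P \<Longrightarrow> \<not> w1_move p q"
    and absorbing: "\<And>p. p \<notin> P \<Longrightarrow> \<exists>q \<in> P. w1_move p q"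
  shows "w1_nim_value p = 0 \<longleftrightarrow> p \<in> P"
proof (induction p rule: measure_induct_rule[of total_tokens])
  case (less p)
  then have "w1_nim_value p = 0 \<longleftrightarrow> (\<forall>q. w1_move p q \<longrightarrow> q \<notin> P)"
    by (subst nim_value_eq_0_iff) (use w1_move_total_tokens in blast)
  then show ?case using stable absorbing by blast
qed

lemma nim_value_1_if_kernel:
  assumes disjoint: "\<And>p. p \<in> Q \<Longrightarrow> w1_nim_value p \<noteq> 0"
    and stable: "\<And>p q. p \<in> Q \<Longrightarrow> q \<in> Q \<Longrightarrow> \<not> w1_move p q"
    and absorbing: "\<And>p. w1_nim_value p \<noteq> 0 \<Longrightarrow> p \<notin> Q \<Longrightarrow> \<exists>q \<in> Q. w1_move p q"
  shows "w1_nim_value p = 1 \<longleftrightarrow> p \<in> Q"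
proof (induction p rule: measure_induct_rule[of total_tokens])
  case (less p)
  then have "w1_nim_value p = 1 \<longleftrightarrow> w1_nim_value p \<noteq> 0 \<and> (\<forall>q. w1_move p q \<longrightarrow> q \<notin> Q)"
    by (subst nim_value_eq_1_iff) (use w1_move_total_tokens in blast)
  then show ?case using disjoint stable absorbing by blast
qed

text \<open>Diagonal moves may not empty a pile, so an empty pile in the result was empty before or is the
  pile that was reduced. Hence the result keeps one of the old pile sizes. This shows that \<open>(0,0)\<close>
  and \<open>(0,1)\<close> cannot be reached from positions with both piles large enough.\<close>

lemma w1_move_to_empty_pile:
  assumes "w1_move (Upair a b) (Upair 0 d)"
  shows "a = 0 \<and> d < b \<or> b = 0 \<and> d < a \<or> a = d \<and> 0 < b \<or> b = d \<and> 0 < a"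
  using assms by cases auto

text \<open>The empty position cannot interfere with the pairs of shift 1: a position with two nonempty
  piles is at least two moves away from it.\<close>

lemma nim_value_0_positions:
  "w1_nim_value p = 0 \<longleftrightarrow> p \<in> insert (Upair 0 0) (shifted_wythoff 1)"
proof (rule nim_value_0_if_kernel)
  fix p q
  assume p: "p \<in> insert (Upair 0 0) (shifted_wythoff 1)"
    and q: "q \<in> insert (Upair 0 0) (shifted_wythoff 1)"
  obtain a b where ab: "p = Upair a b" by (cases p)
  show "\<not> w1_move p q"
  proof
    assume move: "w1_move p q"
    have "p \<noteq> Upair 0 0"
      using w1_move_total_tokens[OF move] by (auto simp: total_tokens.abs_eq Upair.abs_eq)
    with p ab have p': "p \<in> shifted_wythoff 1" "a \<ge> 1" "b \<ge> 1"
      using shifted_wythoff_piles_ge by auto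
    then have "q \<noteq> Upair 0 0" using w1_move_to_empty_pile[of a b 0] move ab by auto
    then show False using shifted_wythoff_stable p' q move by blast
  qed
next
  fix p
  assume p: "p \<notin> insert (Upair 0 0) (shifted_wythoff 1)"
  obtain a b where ab: "p = Upair a b" by (cases p)
  consider "a = 0" "b > 0" | "b = 0" "a > 0" | "a \<ge> 1" "b \<ge> 1"
    using p ab by force
  then show "\<exists>q \<in> insert (Upair 0 0) (shifted_wythoff 1). w1_move p q"
  proof cases
    case 1
    then show ?thesis using w1_move_second_pile[of 0 b 0] ab by auto
  next
    case 2
    then show ?thesis using w1_move_first_pile[of 0 a 0] ab by auto
  next
    case 3
    then show ?thesis using shifted_wythoff_absorbing[of 1 a b] p ab by auto
  qed
qed

lemma nim_value_1_positions:
  "w1_nim_value p = 1 \<longleftrightarrow> p \<in> insert (Upair 0 1) (shifted_wythoff 2)"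
proof (rule nim_value_1_if_kernel)
  fix p
  assume p: "p \<in> insert (Upair 0 1) (shifted_wythoff 2)"
  have "Upair 0 1 \<notin> shifted_wythoff 1" "Upair 0 0 \<notin> shifted_wythoff 2"
    using shifted_wythoff_piles_ge by fastforce+
  moreover have "shifted_wythoff 1 \<inter> shifted_wythoff 2 = {}"
    using shifted_wythoff_Suc_disjoint[of 1] by (simp add: numeral_2_eq_2)
  ultimately show "w1_nim_value p \<noteq> 0"
    using p by (auto simp: nim_value_0_positions)
next
  fix p q
  assume p: "p \<in> insert (Upair 0 1) (shifted_wythoff 2)"
    and q: "q \<in> insert (Upair 0 1) (shifted_wythoff 2)"
  obtain a b where ab: "p = Upair a b" by (cases p)
  obtain c d where cd: "q = Upair c d" by (cases q)
  show "\<not> w1_move p q"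
  proof
    assume move: "w1_move p q"
    have "c + d < a + b"
      using w1_move_total_tokens[OF move] ab cd by (simp add: total_tokens.abs_eq Upair.abs_eq)
    moreover have "c + d \<ge> 1" using q cd shifted_wythoff_piles_ge by fastforce
    ultimately have "p \<noteq> Upair 0 1" using ab by auto
    with p ab have p': "p \<in> shifted_wythoff 2" "a \<ge> 2" "b \<ge> 2"
      using shifted_wythoff_piles_ge by auto
    then have "q \<noteq> Upair 0 1" using w1_move_to_empty_pile[of a b 1] move ab by auto
    then show False using shifted_wythoff_stable p' q move by blast
  qed
next
  fix p
  assume nonzero: "w1_nim_value p \<noteq> 0" and p: "p \<notin> insert (Upair 0 1) (shifted_wythoff 2)"
  obtain a b where ab: "p = Upair a b" and "a \<le> b"
    by (cases p) (metis Upair_swap nle_le)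
  \<comment> \<open>The pair with index 0.\<close>
  have "Upair 1 1 \<in> shifted_wythoff 1"
    by (auto simp: shifted_wythoff_def A_0 B_eq intro!: exI[of _ 0])
  then have "p \<noteq> Upair 0 0" "p \<noteq> Upair 1 1"
    using nonzero by (auto simp: nim_value_0_positions)
  then consider "a = 0" "b > 1" | "a = 1" "b > 1" | "a \<ge> 2" "b \<ge> 2"
    using p ab \<open>a \<le> b\<close> by (cases "a = 0"; cases "a = 1"; cases "b = 0"; cases "b = 1") auto
  then show "\<exists>q \<in> insert (Upair 0 1) (shifted_wythoff 2). w1_move p q"
  proof cases
    case 1
    then show ?thesis using w1_move_second_pile[of 1 b 0] ab by auto
  next
    case 2
    then have "w1_move p (Upair 1 0)" using w1_move_second_pile[of 0 b 1] ab by simp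
    then show ?thesis by (auto simp: Upair_swap)
  next
    case 3
    then show ?thesis using shifted_wythoff_absorbing[of 2 a b] p ab by auto
  qed
qed

theorem theorem6:
  "{p. w1_nim_value p = 1} = {Upair 0 1} \<union> {Upair (A n + 2) (B n + 2) | n. n \<ge> 0}"
  unfolding nim_value_1_positions by (auto simp: shifted_wythoff_def)

end
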